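(* Let $A=B\vee C$ be the coproduct of two connected, finite-type, graded, graded-commutative $\mathbb{C}$-algebras $B$ and $C$, and identify $A^1=B^1\oplus C^1$ with $B^1\times C^1$. Let $d$ be an integer, and set $s=d-\dim B^1$ and $t=d-\dim C^1$. Then $$\mathcal{R}^1_d(B\vee C)=\Big(\bigcup_{j+k=d-1}(\mathcal{R}^1_j(B)\setminus\{0\})\times(\mathcal{R}^1_k(C)\setminus\{0\})\Big)\cup\big(\{0\}\times\mathcal{R}^1_s(C)\big)\cup\big(\mathcal{R}^1_t(B)\times\{0\}\big),$$ and, for all $i\ge2$, $$\mathcal{R}^i_d(B\vee C)=\bigcup_{j+k=d}\mathcal{R}^i_j(B)\times\mathcal{R}^i_k(C).$$
   Context: A graded, graded-commutative $\mathbb{C}$-algebra $A=\bigoplus_{i\ge0}A^i$ is connected if $A^0=\mathbb{C}$ and of finite type if $\dim A^i<\infty$ for all $i$. For $a\in A^1$, let $(A,a)$ be the cochain complex with differentials $A^i\to A^{i+1}$, $u\mapsto a\cdot u$, and let $b_i(A,a)=\dim_{\mathbb{C}}H^i(A,a)$. The resonance varieties are $\mathcal{R}^i_d(A)=\{a\in A^1\mid b_i(A,a)\ge d\}$; in particular $\mathcal{R}^i_d(A)=A^1$ for $d\le0$. The coproduct $B\vee C$ is the connected graded algebra with $(B\vee C)^i=B^i\oplus C^i$ for $i\ge1$, with multiplication in positive degrees given by $(b,c)(b',c')=(bb',cc')$. The indices $j,k$ in the unions range over integers. *)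

theory Defs
  imports "HOL-Algebra.AbelCoset" "Jordan_Normal_Form.VS_Connect"
begin

section \<open>Quotients of vector spaces\<close>

text \<open>
  The elements are the cosets \<open>W + v\<close>. The fields \<open>mult\<close> and \<open>one\<close> of the record
  type \<open>module\<close> are inherited from \<open>ring\<close>, play no role for modules, and get dummy values.
\<close>

definition quotient_space ::
    "('k, 'v, 'm) module_scheme \<Rightarrow> 'v set \<Rightarrow> ('k, 'v set) module" where
  "quotient_space V W = \<lparr>
     carrier = a_rcosets\<^bsub>V\<^esub> W,
     mult = (\<lambda>X Y. W),
     one = W,
     zero = W,
     add = set_add V,
     smult = (\<lambda>k X. \<Union>x\<in>X. W +>\<^bsub>V\<^esub> (k \<odot>\<^bsub>V\<^esub> x))\<rparr>"

abbreviation cvectorspace :: "(complex, 'v, 'm) module_scheme \<Rightarrow> bool" where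
  "cvectorspace V \<equiv> vectorspace class_ring V"

abbreviation cdim :: "(complex, 'v, 'm) module_scheme \<Rightarrow> nat" where
  "cdim V \<equiv> vectorspace.dim class_ring V"


section \<open>Graded algebras\<close>

text \<open>
  A graded algebra \<open>\<Oplus>i. A\<^sup>i\<close> is given by its homogeneous components and the
  multiplication maps \<open>A\<^sup>i \<times> A\<^sup>j \<rightarrow> A\<^sup>i\<^sup>+\<^sup>j\<close>, which determine it. The components are separate
  spaces that may overlap as sets, so the multiplication carries the two degrees.
\<close>

record 'a graded_alg =
  component :: "nat \<Rightarrow> (complex, 'a) module"
  gmult :: "nat \<Rightarrow> nat \<Rightarrow> 'a \<Rightarrow> 'a \<Rightarrow> 'a"
  gone :: 'a

locale graded_algebra =
  fixes A :: "'a graded_alg"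
  assumes component_vectorspace: "cvectorspace (component A i)"
    and gmult_closed:
      "\<lbrakk>x \<in> carrier (component A i); y \<in> carrier (component A j)\<rbrakk>
       \<Longrightarrow> gmult A i j x y \<in> carrier (component A (i + j))"
    and gmult_add_left:
      "\<lbrakk>x \<in> carrier (component A i); x' \<in> carrier (component A i);
        y \<in> carrier (component A j)\<rbrakk>
       \<Longrightarrow> gmult A i j (x \<oplus>\<^bsub>component A i\<^esub> x') y
           = gmult A i j x y \<oplus>\<^bsub>component A (i + j)\<^esub> gmult A i j x' y"
    and gmult_add_right:
      "\<lbrakk>x \<in> carrier (component A i); y \<in> carrier (component A j);
        y' \<in> carrier (component A j)\<rbrakk>
       \<Longrightarrow> gmult A i j x (y \<oplus>\<^bsub>component A j\<^esub> y')
           = gmult A i j x y \<oplus>\<^bsub>component A (i + j)\<^esub> gmult A i j x y'"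
    and gmult_smult_left:
      "\<lbrakk>x \<in> carrier (component A i); y \<in> carrier (component A j)\<rbrakk>
       \<Longrightarrow> gmult A i j (z \<odot>\<^bsub>component A i\<^esub> x) y = z \<odot>\<^bsub>component A (i + j)\<^esub> gmult A i j x y"
    and gmult_smult_right:
      "\<lbrakk>x \<in> carrier (component A i); y \<in> carrier (component A j)\<rbrakk>
       \<Longrightarrow> gmult A i j x (z \<odot>\<^bsub>component A j\<^esub> y) = z \<odot>\<^bsub>component A (i + j)\<^esub> gmult A i j x y"
    and gmult_assoc:
      "\<lbrakk>x \<in> carrier (component A i); y \<in> carrier (component A j);
        w \<in> carrier (component A k)\<rbrakk>
       \<Longrightarrow> gmult A (i + j) k (gmult A i j x y) w = gmult A i (j + k) x (gmult A j k y w)"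
    and gone_closed: "gone A \<in> carrier (component A 0)"
    and gmult_one_left: "x \<in> carrier (component A i) \<Longrightarrow> gmult A 0 i (gone A) x = x"
    and gmult_one_right: "x \<in> carrier (component A i) \<Longrightarrow> gmult A i 0 x (gone A) = x"

locale graded_commutative_algebra = graded_algebra +
  assumes gmult_comm:
    "\<lbrakk>x \<in> carrier (component A i); y \<in> carrier (component A j)\<rbrakk>
     \<Longrightarrow> gmult A i j x y = (- 1) ^ (i * j) \<odot>\<^bsub>component A (i + j)\<^esub> gmult A j i y x"

text \<open>\<open>A\<^sup>0 = \<complex>\<close>, in the sense that the unit map \<open>z \<mapsto> z \<cdot> 1\<close> identifies \<open>\<complex>\<close> with \<open>A\<^sup>0\<close>.\<close>

definition connected_algebra :: "'a graded_alg \<Rightarrow> bool" where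
  "connected_algebra A \<longleftrightarrow>
     bij_betw (\<lambda>z. z \<odot>\<^bsub>component A 0\<^esub> gone A) UNIV (carrier (component A 0))"

definition finite_type :: "'a graded_alg \<Rightarrow> bool" where
  "finite_type A \<longleftrightarrow> (\<forall>i. vectorspace.fin_dim class_ring (component A i))"


section \<open>Resonance varieties\<close>

definition cocycles :: "'a graded_alg \<Rightarrow> 'a \<Rightarrow> nat \<Rightarrow> 'a set" where
  "cocycles A a i =
     {u \<in> carrier (component A i). gmult A 1 i a u = \<zero>\<^bsub>component A (Suc i)\<^esub>}"

definition coboundaries :: "'a graded_alg \<Rightarrow> 'a \<Rightarrow> nat \<Rightarrow> 'a set" where
  "coboundaries A a i =
     (case i of
        0 \<Rightarrow> {\<zero>\<^bsub>component A 0\<^esub>}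
      | Suc k \<Rightarrow> gmult A 1 k a ` carrier (component A k))"

definition cohomology :: "'a graded_alg \<Rightarrow> 'a \<Rightarrow> nat \<Rightarrow> (complex, 'a set) module" where
  "cohomology A a i =
     quotient_space ((component A i)\<lparr>carrier := cocycles A a i\<rparr>) (coboundaries A a i)"

definition betti :: "'a graded_alg \<Rightarrow> 'a \<Rightarrow> nat \<Rightarrow> nat" where
  "betti A a i = cdim (cohomology A a i)"

definition resonance :: "nat \<Rightarrow> int \<Rightarrow> 'a graded_alg \<Rightarrow> 'a set" where
  "resonance i d A = {a \<in> carrier (component A 1). int (betti A a i) \<ge> d}"


section \<open>Coproducts\<close>

text \<open>
  In degree 0 the coproduct is a single copy of \<open>\<complex>\<close>, realised as the multiples of
  the unit \<open>(1, 1)\<close>. With this choice the componentwise product is also right when one factor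
  has degree 0: \<open>(z \<cdot> 1, z \<cdot> 1)\<close> times \<open>(b, c)\<close> is \<open>(z \<cdot> b, z \<cdot> c)\<close>.
\<close>

definition coproduct :: "'b graded_alg \<Rightarrow> 'c graded_alg \<Rightarrow> ('b \<times> 'c) graded_alg"
    (infixr \<open>\<or>\<^sub>g\<close> 65) where
  "B \<or>\<^sub>g C = \<lparr>
     component = (\<lambda>i.
       if i = 0
       then (direct_sum (component B 0) (component C 0))
              \<lparr>carrier := range (\<lambda>z. (z \<odot>\<^bsub>component B 0\<^esub> gone B, z \<odot>\<^bsub>component C 0\<^esub> gone C))\<rparr>
       else direct_sum (component B i) (component C i)),
     gmult = (\<lambda>i j (b, c) (b', c'). (gmult B i j b b', gmult C i j c c')),
     gone = (gone B, gone C)\<rparr>"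


section \<open>Well-definedness\<close>

subsection \<open>Cohomology is a vector space\<close>

lemma subspace_abelian_subgroup:
  assumes "vectorspace K V" and "subspace K W V"
  shows "abelian_subgroup W V"
proof -
  interpret V: vectorspace K V by fact
  interpret W: submodule K W V using assms(2) unfolding subspace_def by blast
  show ?thesis
  proof (rule abelian_subgroupI3)
    show "additive_subgroup W V"
    proof (intro additive_subgroupI V.M.add.subgroupI)
      show "W \<subseteq> carrier V" "W \<noteq> {}"
        using W.subset W.zero_closed by blast+
      show "\<ominus>\<^bsub>V\<^esub> a \<in> W" if "a \<in> W" for a
        using that W.subset V.smult_minus_1 W.smult_closed
        by (metis V.R.add.inv_closed V.R.one_closed subsetD)
    qed auto
    show "abelian_group V" by (rule V.M.abelian_group_axioms)
  qed
qed

lemma quotient_space_smult_coset: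
  assumes "vectorspace K V" and "subspace K W V" and "k \<in> carrier K" and "v \<in> carrier V"
  shows "k \<odot>\<^bsub>quotient_space V W\<^esub> (W +>\<^bsub>V\<^esub> v) = W +>\<^bsub>V\<^esub> (k \<odot>\<^bsub>V\<^esub> v)"
proof -
  interpret V: vectorspace K V by fact
  interpret W: submodule K W V using assms(2) unfolding subspace_def by blast
  interpret G: abelian_subgroup W V by (rule subspace_abelian_subgroup[OF assms(1,2)])
  have eq: "W +>\<^bsub>V\<^esub> (k \<odot>\<^bsub>V\<^esub> x) = W +>\<^bsub>V\<^esub> (k \<odot>\<^bsub>V\<^esub> v)" if x: "x \<in> W +>\<^bsub>V\<^esub> v" for x
  proof -
    obtain w where w: "w \<in> W" "x = w \<oplus>\<^bsub>V\<^esub> v"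
      using x unfolding a_r_coset_def' by auto
    have wV: "w \<in> carrier V" using w W.subset by auto
    have "k \<odot>\<^bsub>V\<^esub> x = k \<odot>\<^bsub>V\<^esub> w \<oplus>\<^bsub>V\<^esub> k \<odot>\<^bsub>V\<^esub> v"
      using w wV assms by (simp add: V.smult_r_distr)
    then have "k \<odot>\<^bsub>V\<^esub> x \<in> W +>\<^bsub>V\<^esub> (k \<odot>\<^bsub>V\<^esub> v)"
      using W.smult_closed[OF assms(3) w(1)] unfolding a_r_coset_def' by auto
    then show ?thesis
      using G.a_repr_independence'[of "k \<odot>\<^bsub>V\<^esub> x" "k \<odot>\<^bsub>V\<^esub> v"] assms by auto
  qed
  have "W +>\<^bsub>V\<^esub> v \<noteq> {}" using G.a_rcos_self[OF assms(4)] by blast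
  then have "(\<Union>x\<in>W +>\<^bsub>V\<^esub> v. W +>\<^bsub>V\<^esub> (k \<odot>\<^bsub>V\<^esub> x)) = W +>\<^bsub>V\<^esub> (k \<odot>\<^bsub>V\<^esub> v)"
    by (rule SUP_eq_const) (rule eq)
  then show ?thesis by (simp add: quotient_space_def)
qed

lemma quotient_space_vectorspace:
  assumes "vectorspace K V" and "subspace K W V"
  shows "vectorspace K (quotient_space V W)"
proof -
  interpret V: vectorspace K V by fact
  interpret W: submodule K W V using assms(2) unfolding subspace_def by blast
  interpret G: abelian_subgroup W V by (rule subspace_abelian_subgroup[OF assms(1,2)])
  let ?Q = "quotient_space V W"
  have sm: "k \<odot>\<^bsub>?Q\<^esub> (W +>\<^bsub>V\<^esub> v) = W +>\<^bsub>V\<^esub> (k \<odot>\<^bsub>V\<^esub> v)"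
    if "k \<in> carrier K" "v \<in> carrier V" for k v
    using quotient_space_smult_coset[OF assms that] .
  have ad: "(W +>\<^bsub>V\<^esub> u) \<oplus>\<^bsub>?Q\<^esub> (W +>\<^bsub>V\<^esub> v) = W +>\<^bsub>V\<^esub> (u \<oplus>\<^bsub>V\<^esub> v)"
    if "u \<in> carrier V" "v \<in> carrier V" for u v
    using G.a_rcos_sum that by (simp add: quotient_space_def)
  have ze: "\<zero>\<^bsub>?Q\<^esub> = W +>\<^bsub>V\<^esub> \<zero>\<^bsub>V\<^esub>"
    using W.subset by (simp add: quotient_space_def V.M.a_coset_add_zero)
  have ca: "carrier ?Q = (\<lambda>v. W +>\<^bsub>V\<^esub> v) ` carrier V"
    unfolding quotient_space_def by (auto simp: A_RCOSETS_def')
  have "abelian_group ?Q"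
  proof (rule abelian_groupI)
    fix x assume "x \<in> carrier ?Q"
    then obtain v where v: "v \<in> carrier V" "x = W +>\<^bsub>V\<^esub> v" by (auto simp: ca)
    show "\<exists>y\<in>carrier ?Q. y \<oplus>\<^bsub>?Q\<^esub> x = \<zero>\<^bsub>?Q\<^esub>"
      by (rule bexI[of _ "W +>\<^bsub>V\<^esub> (\<ominus>\<^bsub>V\<^esub> v)"]) (use v in \<open>auto simp: ad ze ca V.M.l_neg\<close>)
  qed (auto simp: ca ad ze V.M.a_ac)
  then have "module K ?Q"
    by (intro moduleI V.R.cring_axioms V.module.R.cring_axioms)
       (auto simp: ca ad sm V.smult_l_distr V.smult_r_distr V.smult_assoc1)
  then show ?thesis by (intro vectorspace.intro V.field.field_axioms V.field_axioms)
qed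

lemma (in graded_algebra) gmult_zero_right:
  assumes "x \<in> carrier (component A i)"
  shows "gmult A i j x \<zero>\<^bsub>component A j\<^esub> = \<zero>\<^bsub>component A (i + j)\<^esub>"
proof -
  interpret J: vectorspace class_ring "component A j" by (rule component_vectorspace)
  interpret IJ: vectorspace class_ring "component A (i + j)" by (rule component_vectorspace)
  have "gmult A i j x (0 \<odot>\<^bsub>component A j\<^esub> \<zero>\<^bsub>component A j\<^esub>) =
      0 \<odot>\<^bsub>component A (i + j)\<^esub> gmult A i j x \<zero>\<^bsub>component A j\<^esub>"
    by (rule gmult_smult_right) (use assms in auto)
  moreover have "gmult A i j x \<zero>\<^bsub>component A j\<^esub> \<in> carrier (component A (i + j))"
    by (rule gmult_closed) (use assms in auto)
  ultimately show ?thesis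
    using J.lmult_0[OF J.M.zero_closed] IJ.lmult_0 by simp
qed

lemma (in graded_algebra) gmult_zero_left:
  assumes "y \<in> carrier (component A j)"
  shows "gmult A i j \<zero>\<^bsub>component A i\<^esub> y = \<zero>\<^bsub>component A (i + j)\<^esub>"
proof -
  interpret I: vectorspace class_ring "component A i" by (rule component_vectorspace)
  interpret IJ: vectorspace class_ring "component A (i + j)" by (rule component_vectorspace)
  have "gmult A i j (0 \<odot>\<^bsub>component A i\<^esub> \<zero>\<^bsub>component A i\<^esub>) y =
      0 \<odot>\<^bsub>component A (i + j)\<^esub> gmult A i j \<zero>\<^bsub>component A i\<^esub> y"
    by (rule gmult_smult_left) (use assms in auto)
  moreover have "gmult A i j \<zero>\<^bsub>component A i\<^esub> y \<in> carrier (component A (i + j))"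
    by (rule gmult_closed) (use assms in auto)
  ultimately show ?thesis
    using I.lmult_0[OF I.M.zero_closed] IJ.lmult_0 by simp
qed

lemma (in graded_commutative_algebra) gmult_self_degree_one:
  assumes "a \<in> carrier (component A 1)"
  shows "gmult A 1 1 a a = \<zero>\<^bsub>component A (1 + 1)\<^esub>"
proof -
  interpret V: vectorspace class_ring "component A (1 + 1)" by (rule component_vectorspace)
  let ?x = "gmult A 1 1 a a"
  have x: "?x \<in> carrier (component A (1 + 1))" by (rule gmult_closed) fact+
  have "?x = (- 1) \<odot>\<^bsub>component A (1 + 1)\<^esub> ?x"
    using gmult_comm[OF assms assms] by simp
  then have "2 \<odot>\<^bsub>component A (1 + 1)\<^esub> ?x = \<zero>\<^bsub>component A (1 + 1)\<^esub>"
    using V.smult_l_distr[of 1 1 ?x] V.smult_l_distr[of 1 "-1" ?x] V.smult_one[OF x]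
      V.lmult_0[OF x] x by simp
  then have "(1/2) \<odot>\<^bsub>component A (1 + 1)\<^esub> (2 \<odot>\<^bsub>component A (1 + 1)\<^esub> ?x) = \<zero>\<^bsub>component A (1 + 1)\<^esub>"
    using V.rmult_0[of "1/2"] by simp
  then show ?thesis
    using V.smult_assoc1[of "1/2" 2 ?x] V.smult_one[OF x] x by simp
qed

lemma (in graded_commutative_algebra) subspace_cocycles:
  assumes "a \<in> carrier (component A 1)"
  shows "subspace class_ring (cocycles A a i) (component A i)"
proof -
  interpret V: vectorspace class_ring "component A i" by (rule component_vectorspace)
  interpret V': vectorspace class_ring "component A (Suc i)" by (rule component_vectorspace)
  have "submodule class_ring (cocycles A a i) (component A i)"
    using gmult_add_right[OF assms, of _ i] gmult_smult_right[OF assms, of _ i]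
      gmult_zero_right[OF assms, of i] V.module_axioms
    by unfold_locales (auto simp: cocycles_def)
  then show ?thesis using V.vectorspace_axioms by (simp add: subspace_def)
qed

lemma (in graded_commutative_algebra) subspace_coboundaries:
  assumes a: "a \<in> carrier (component A 1)"
  shows "subspace class_ring (coboundaries A a i) ((component A i)\<lparr>carrier := cocycles A a i\<rparr>)"
proof -
  interpret V: vectorspace class_ring "component A i" by (rule component_vectorspace)
  let ?Z = "(component A i)\<lparr>carrier := cocycles A a i\<rparr>"
  interpret Z: vectorspace class_ring ?Z by (rule V.subspace_is_vs[OF subspace_cocycles[OF a]])
  have "submodule class_ring (coboundaries A a i) ?Z"
  proof (cases i)
    case 0
    show ?thesis
      using Z.module_axioms Z.M.zero_closed Z.rmult_0 Z.M.l_zero[OF Z.M.zero_closed]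
      by unfold_locales (auto simp: coboundaries_def 0)
  next
    case (Suc k)
    interpret U: vectorspace class_ring "component A k" by (rule component_vectorspace)
    interpret V2: vectorspace class_ring "component A (Suc k)" by (rule component_vectorspace)
    have z: "gmult A 1 (Suc k) a (gmult A 1 k a v) = \<zero>\<^bsub>component A (Suc (Suc k))\<^esub>"
      if "v \<in> carrier (component A k)" for v
      using gmult_assoc[OF a a that] gmult_zero_left[OF that, of 2]
        gmult_self_degree_one[OF a] by (simp add: numeral_2_eq_2)
    have c: "gmult A 1 k a v \<in> carrier (component A (Suc k))" if "v \<in> carrier (component A k)" for v
      using gmult_closed[OF a that] by simp
    have A: "gmult A 1 k a v \<oplus>\<^bsub>component A (Suc k)\<^esub> gmult A 1 k a w
        = gmult A 1 k a (v \<oplus>\<^bsub>component A k\<^esub> w)"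
      if "v \<in> carrier (component A k)" "w \<in> carrier (component A k)" for v w
      using gmult_add_right[OF a that] by simp
    have S: "r \<odot>\<^bsub>component A (Suc k)\<^esub> gmult A 1 k a v = gmult A 1 k a (r \<odot>\<^bsub>component A k\<^esub> v)"
      if "v \<in> carrier (component A k)" for v r
      using gmult_smult_right[OF a that] by simp
    have Z: "\<zero>\<^bsub>component A (Suc k)\<^esub> = gmult A 1 k a \<zero>\<^bsub>component A k\<^esub>"
      using gmult_zero_right[OF a, of k] by simp
    show ?thesis
    proof (rule submodule.intro)
      show "Module.module class_ring ?Z" by (rule Z.module_axioms)
    qed (auto simp: coboundaries_def cocycles_def Suc A S z c simp del: One_nat_def, auto simp: Z)
  qed
  then show ?thesis using Z.vectorspace_axioms by (simp add: subspace_def)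
qed

lemma (in graded_commutative_algebra) cohomology_vectorspace:
  assumes "a \<in> carrier (component A 1)"
  shows "cvectorspace (cohomology A a i)"
  unfolding cohomology_def
  by (intro quotient_space_vectorspace subspace_coboundaries assms
      vectorspace.subspace_is_vs[OF component_vectorspace] subspace_cocycles)

subsection \<open>The coproduct is a connected graded-commutative algebra of finite type\<close>

lemma coproduct_simps:
  "carrier (component (B \<or>\<^sub>g C) i) =
     (if i = 0
      then range (\<lambda>z. (z \<odot>\<^bsub>component B 0\<^esub> gone B, z \<odot>\<^bsub>component C 0\<^esub> gone C))
      else carrier (component B i) \<times> carrier (component C i))"
  "\<zero>\<^bsub>component (B \<or>\<^sub>g C) i\<^esub> = (\<zero>\<^bsub>component B i\<^esub>, \<zero>\<^bsub>component C i\<^esub>)"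
  "u \<oplus>\<^bsub>component (B \<or>\<^sub>g C) i\<^esub> v =
     (fst u \<oplus>\<^bsub>component B i\<^esub> fst v, snd u \<oplus>\<^bsub>component C i\<^esub> snd v)"
  "z \<odot>\<^bsub>component (B \<or>\<^sub>g C) i\<^esub> u =
     (z \<odot>\<^bsub>component B i\<^esub> fst u, z \<odot>\<^bsub>component C i\<^esub> snd u)"
  "gmult (B \<or>\<^sub>g C) i j u v = (gmult B i j (fst u) (fst v), gmult C i j (snd u) (snd v))"
  "gone (B \<or>\<^sub>g C) = (gone B, gone C)"
  by (auto simp: coproduct_def direct_sum_def split: prod.splits)

lemma submodule_coproduct_degree_zero:
  assumes "graded_algebra B" and "graded_algebra C"
  shows "submodule class_ring
    (range (\<lambda>z. (z \<odot>\<^bsub>component B 0\<^esub> gone B, z \<odot>\<^bsub>component C 0\<^esub> gone C)))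
    (direct_sum (component B 0) (component C 0))"
proof -
  interpret B: graded_algebra B by fact
  interpret C: graded_algebra C by fact
  interpret VB: vectorspace class_ring "component B 0" by (rule B.component_vectorspace)
  interpret VC: vectorspace class_ring "component C 0" by (rule C.component_vectorspace)
  interpret D: vectorspace class_ring "direct_sum (component B 0) (component C 0)"
    by (intro direct_sum_is_vs VB.vectorspace_axioms VC.vectorspace_axioms)
  note [simp] = B.gone_closed C.gone_closed
  show ?thesis
  proof (rule submodule.intro)
    show "Module.module class_ring (direct_sum (component B 0) (component C 0))"
      by (rule D.module_axioms)
    fix v w
    assume "v \<in> range (\<lambda>z. (z \<odot>\<^bsub>component B 0\<^esub> gone B, z \<odot>\<^bsub>component C 0\<^esub> gone C))"
      and "w \<in> range (\<lambda>z. (z \<odot>\<^bsub>component B 0\<^esub> gone B, z \<odot>\<^bsub>component C 0\<^esub> gone C))"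
    then show "v \<oplus>\<^bsub>direct_sum (component B 0) (component C 0)\<^esub> w
      \<in> range (\<lambda>z. (z \<odot>\<^bsub>component B 0\<^esub> gone B, z \<odot>\<^bsub>component C 0\<^esub> gone C))"
      using VB.smult_l_distr[of _ _ "gone B"] VC.smult_l_distr[of _ _ "gone C"]
      by (auto simp: direct_sum_def image_iff) metis
  next
    fix c v
    assume "v \<in> range (\<lambda>z. (z \<odot>\<^bsub>component B 0\<^esub> gone B, z \<odot>\<^bsub>component C 0\<^esub> gone C))"
    then show "c \<odot>\<^bsub>direct_sum (component B 0) (component C 0)\<^esub> v
      \<in> range (\<lambda>z. (z \<odot>\<^bsub>component B 0\<^esub> gone B, z \<odot>\<^bsub>component C 0\<^esub> gone C))"
      using VB.smult_assoc1[of _ _ "gone B"] VC.smult_assoc1[of _ _ "gone C"]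
      by (auto simp: direct_sum_def image_iff) metis
  next
    show "\<zero>\<^bsub>direct_sum (component B 0) (component C 0)\<^esub>
      \<in> range (\<lambda>z. (z \<odot>\<^bsub>component B 0\<^esub> gone B, z \<odot>\<^bsub>component C 0\<^esub> gone C))"
      using VB.lmult_0[of "gone B"] VC.lmult_0[of "gone C"]
      by (auto simp: direct_sum_def image_iff intro!: exI[of _ 0])
  qed (auto simp: direct_sum_def)
qed

lemma coproduct_graded_commutative_algebra:
  assumes "graded_commutative_algebra B" and "graded_commutative_algebra C"
  shows "graded_commutative_algebra (B \<or>\<^sub>g C)"
proof -
  interpret B: graded_commutative_algebra B by fact
  interpret C: graded_commutative_algebra C by fact
  have VB: "cvectorspace (component B i)" and VC: "cvectorspace (component C i)" for i
    by (rule B.component_vectorspace C.component_vectorspace)+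
  have SB: "z \<odot>\<^bsub>component B 0\<^esub> gone B \<in> carrier (component B 0)" for z
    using Module.module.smult_closed[OF vectorspace.axioms(1)[OF VB]] B.gone_closed by auto
  have SC: "z \<odot>\<^bsub>component C 0\<^esub> gone C \<in> carrier (component C 0)" for z
    using Module.module.smult_closed[OF vectorspace.axioms(1)[OF VC]] C.gone_closed by auto
  have sub: "fst u \<in> carrier (component B i)" "snd u \<in> carrier (component C i)"
    if "u \<in> carrier (component (B \<or>\<^sub>g C) i)" for u i
    using that SB SC by (auto simp: coproduct_simps split: if_splits)
  have aB: "z \<odot>\<^bsub>component B 0\<^esub> (w \<odot>\<^bsub>component B 0\<^esub> gone B) = (z * w) \<odot>\<^bsub>component B 0\<^esub> gone B" for z w
    using Module.module.smult_assoc1[OF vectorspace.axioms(1)[OF VB]] B.gone_closed by auto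
  have aC: "z \<odot>\<^bsub>component C 0\<^esub> (w \<odot>\<^bsub>component C 0\<^esub> gone C) = (z * w) \<odot>\<^bsub>component C 0\<^esub> gone C" for z w
    using Module.module.smult_assoc1[OF vectorspace.axioms(1)[OF VC]] C.gone_closed by auto
  have oB: "1 \<odot>\<^bsub>component B 0\<^esub> gone B = gone B"
    using Module.module.smult_one[OF vectorspace.axioms(1)[OF VB]] B.gone_closed by auto
  have oC: "1 \<odot>\<^bsub>component C 0\<^esub> gone C = gone C"
    using Module.module.smult_one[OF vectorspace.axioms(1)[OF VC]] C.gone_closed by auto
  have v: "cvectorspace (component (B \<or>\<^sub>g C) i)" for i
  proof (cases "i = 0")
    case True
    interpret D: vectorspace class_ring "direct_sum (component B 0) (component C 0)"
      by (intro direct_sum_is_vs VB VC)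
    show ?thesis
      using D.subspace_is_vs[OF subspace.intro[OF D.vectorspace_axioms
            submodule_coproduct_degree_zero[OF B.graded_algebra_axioms C.graded_algebra_axioms]]] True
      by (simp add: coproduct_def)
  next
    case False
    then show ?thesis by (simp add: coproduct_def direct_sum_is_vs VB VC)
  qed
  have cl: "gmult (B \<or>\<^sub>g C) i j x y \<in> carrier (component (B \<or>\<^sub>g C) (i + j))"
    if x: "x \<in> carrier (component (B \<or>\<^sub>g C) i)" and y: "y \<in> carrier (component (B \<or>\<^sub>g C) j)" for i j x y
  proof (cases "i + j = 0")
    case True
    then obtain z w where
      "x = (z \<odot>\<^bsub>component B 0\<^esub> gone B, z \<odot>\<^bsub>component C 0\<^esub> gone C)"
      "y = (w \<odot>\<^bsub>component B 0\<^esub> gone B, w \<odot>\<^bsub>component C 0\<^esub> gone C)"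
      using x y by (auto simp: coproduct_simps)
    moreover have "gmult B 0 0 (z \<odot>\<^bsub>component B 0\<^esub> gone B) (w \<odot>\<^bsub>component B 0\<^esub> gone B)
        = (z * w) \<odot>\<^bsub>component B 0\<^esub> gone B"
      using B.gmult_smult_left[of "gone B" 0 "w \<odot>\<^bsub>component B 0\<^esub> gone B" 0 z] SB B.gone_closed
        B.gmult_one_left[OF SB] aB by simp
    moreover have "gmult C 0 0 (z \<odot>\<^bsub>component C 0\<^esub> gone C) (w \<odot>\<^bsub>component C 0\<^esub> gone C)
        = (z * w) \<odot>\<^bsub>component C 0\<^esub> gone C"
      using C.gmult_smult_left[of "gone C" 0 "w \<odot>\<^bsub>component C 0\<^esub> gone C" 0 z] SC C.gone_closed
        C.gmult_one_left[OF SC] aC by simp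
    ultimately show ?thesis using True by (auto simp: coproduct_simps)
  next
    case False
    then have "carrier (component (B \<or>\<^sub>g C) (i + j)) =
        carrier (component B (i + j)) \<times> carrier (component C (i + j))"
      by (simp only: coproduct_simps if_False)
    then show ?thesis
      using B.gmult_closed[OF sub(1)[OF x] sub(1)[OF y]] C.gmult_closed[OF sub(2)[OF x] sub(2)[OF y]]
      by (simp add: coproduct_simps)
  qed
  have one: "gone (B \<or>\<^sub>g C) \<in> carrier (component (B \<or>\<^sub>g C) 0)"
    using oB oC by (auto simp: coproduct_simps image_iff intro!: exI[of _ 1])
  let ?A = "B \<or>\<^sub>g C"
  have one_left: "gmult ?A 0 i (gone ?A) x = x" if "x \<in> carrier (component ?A i)" for x i
    using sub[OF that] by (simp add: coproduct_simps(5,6) B.gmult_one_left C.gmult_one_left)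
  have one_right: "gmult ?A i 0 x (gone ?A) = x" if "x \<in> carrier (component ?A i)" for x i
    using sub[OF that] by (simp add: coproduct_simps(5,6) B.gmult_one_right C.gmult_one_right)
  have smult_left:
    "gmult ?A i j (z \<odot>\<^bsub>component ?A i\<^esub> x) y = z \<odot>\<^bsub>component ?A (i + j)\<^esub> gmult ?A i j x y"
    if "x \<in> carrier (component ?A i)" "y \<in> carrier (component ?A j)" for x y i j z
    using sub[OF that(1)] sub[OF that(2)]
    by (simp only: coproduct_simps(3-5) fst_conv snd_conv B.gmult_smult_left C.gmult_smult_left)
  have smult_right:
    "gmult ?A i j x (z \<odot>\<^bsub>component ?A j\<^esub> y) = z \<odot>\<^bsub>component ?A (i + j)\<^esub> gmult ?A i j x y"
    if "x \<in> carrier (component ?A i)" "y \<in> carrier (component ?A j)" for x y i j z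
    using sub[OF that(1)] sub[OF that(2)]
    by (simp only: coproduct_simps(3-5) fst_conv snd_conv B.gmult_smult_right C.gmult_smult_right)
  have add_left: "gmult ?A i j (x \<oplus>\<^bsub>component ?A i\<^esub> x') y =
      gmult ?A i j x y \<oplus>\<^bsub>component ?A (i + j)\<^esub> gmult ?A i j x' y"
    if "x \<in> carrier (component ?A i)" "x' \<in> carrier (component ?A i)" "y \<in> carrier (component ?A j)" for x x' y i j
    using sub[OF that(1)] sub[OF that(2)] sub[OF that(3)]
    by (simp only: coproduct_simps(3-5) fst_conv snd_conv B.gmult_add_left C.gmult_add_left)
  have add_right: "gmult ?A i j x (y \<oplus>\<^bsub>component ?A j\<^esub> y') =
      gmult ?A i j x y \<oplus>\<^bsub>component ?A (i + j)\<^esub> gmult ?A i j x y'"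
    if "x \<in> carrier (component ?A i)" "y \<in> carrier (component ?A j)" "y' \<in> carrier (component ?A j)" for x y y' i j
    using sub[OF that(1)] sub[OF that(2)] sub[OF that(3)]
    by (simp only: coproduct_simps(3-5) fst_conv snd_conv B.gmult_add_right C.gmult_add_right)
  have assoc: "gmult ?A (i + j) k (gmult ?A i j x y) w = gmult ?A i (j + k) x (gmult ?A j k y w)"
    if "x \<in> carrier (component ?A i)" "y \<in> carrier (component ?A j)" "w \<in> carrier (component ?A k)" for x y w i j k
    using sub[OF that(1)] sub[OF that(2)] sub[OF that(3)]
    by (simp only: coproduct_simps(3-5) fst_conv snd_conv B.gmult_assoc C.gmult_assoc)
  have comm: "gmult ?A i j x y = (- 1) ^ (i * j) \<odot>\<^bsub>component ?A (i + j)\<^esub> gmult ?A j i y x"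
    if "x \<in> carrier (component ?A i)" "y \<in> carrier (component ?A j)" for x y i j
    using B.gmult_comm[OF sub(1)[OF that(1)] sub(1)[OF that(2)]]
      C.gmult_comm[OF sub(2)[OF that(1)] sub(2)[OF that(2)]]
    by (simp only: coproduct_simps(4,5) fst_conv snd_conv)
  show ?thesis
    by (rule graded_commutative_algebra.intro[OF
          graded_algebra.intro[OF v cl add_left add_right smult_left smult_right assoc one
            one_left one_right]
          graded_commutative_algebra_axioms.intro[OF comm]])
qed

lemma coproduct_connected_algebra:
  assumes "connected_algebra B"
  shows "connected_algebra (B \<or>\<^sub>g C)"
  using assms by (auto simp: connected_algebra_def coproduct_simps bij_betw_def inj_on_def)

lemma coproduct_finite_type:
  assumes "graded_commutative_algebra B" and "graded_commutative_algebra C"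
    and "finite_type B" and "finite_type C"
  shows "finite_type (B \<or>\<^sub>g C)"
proof -
  interpret B: graded_commutative_algebra B by fact
  interpret C: graded_commutative_algebra C by fact
  interpret A: graded_commutative_algebra "B \<or>\<^sub>g C"
    by (rule coproduct_graded_commutative_algebra) fact+
  have "vectorspace.fin_dim class_ring (component (B \<or>\<^sub>g C) i)" for i
  proof -
    interpret VB: vectorspace class_ring "component B i" by (rule B.component_vectorspace)
    interpret VC: vectorspace class_ring "component C i" by (rule C.component_vectorspace)
    interpret V: vectorspace class_ring "component (B \<or>\<^sub>g C) i" by (rule A.component_vectorspace)
    show ?thesis
    proof (cases "i = 0")
      case True
      let ?S = "{gone (B \<or>\<^sub>g C)}"
      have S: "?S \<subseteq> carrier (component (B \<or>\<^sub>g C) i)" using A.gone_closed True by simp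
      have m: "submodule class_ring (V.span ?S) (component (B \<or>\<^sub>g C) i)"
        by (rule V.span_is_submodule[OF S])
      have "carrier (component (B \<or>\<^sub>g C) i) \<subseteq> V.span ?S"
      proof
        fix x assume "x \<in> carrier (component (B \<or>\<^sub>g C) i)"
        then obtain z where "x = z \<odot>\<^bsub>component (B \<or>\<^sub>g C) i\<^esub> gone (B \<or>\<^sub>g C)"
          using True by (auto simp: coproduct_simps)
        then show "x \<in> V.span ?S"
          using submodule.smult_closed[OF m] V.in_own_span[OF S] by auto
      qed
      then show ?thesis
        using S V.span_is_subset2[OF S] unfolding V.fin_dim_def by blast
    next
      case False
      have car: "carrier (component (B \<or>\<^sub>g C) i) = carrier (component B i) \<times> carrier (component C i)"
        using False by (simp add: coproduct_simps)
      obtain S where S: "finite S" "S \<subseteq> carrier (component B i)" "VB.gen_set S"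
        using assms(3) VB.fin_dim_def by (auto simp: finite_type_def)
      obtain T where T: "finite T" "T \<subseteq> carrier (component C i)" "VC.gen_set T"
        using assms(4) VC.fin_dim_def by (auto simp: finite_type_def)
      let ?U = "(\<lambda>x. (x, \<zero>\<^bsub>component C i\<^esub>)) ` S \<union> (\<lambda>y. (\<zero>\<^bsub>component B i\<^esub>, y)) ` T"
      have U: "?U \<subseteq> carrier (component (B \<or>\<^sub>g C) i)" using S T by (auto simp: car)
      have m: "submodule class_ring (V.span ?U) (component (B \<or>\<^sub>g C) i)"
        by (rule V.span_is_submodule[OF U])
      note sub = submodule.m_closed[OF m, unfolded coproduct_simps]
        submodule.zero_closed[OF m, unfolded coproduct_simps]
        submodule.smult_closed[OF m, unfolded coproduct_simps]
      have "submodule class_ring {x \<in> carrier (component B i). (x, \<zero>\<^bsub>component C i\<^esub>) \<in> V.span ?U}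
          (component B i)"
      proof (rule submodule.intro)
        show "Module.module class_ring (component B i)" by (rule VB.module_axioms)
      qed (use sub(1)[of "(_, \<zero>\<^bsub>component C i\<^esub>)" "(_, \<zero>\<^bsub>component C i\<^esub>)"] sub(2)
          sub(3)[of _ "(_, \<zero>\<^bsub>component C i\<^esub>)"] in auto)
      moreover have "S \<subseteq> {x \<in> carrier (component B i). (x, \<zero>\<^bsub>component C i\<^esub>) \<in> V.span ?U}"
        using S V.in_own_span[OF U] by auto
      ultimately have 1: "(x, \<zero>\<^bsub>component C i\<^esub>) \<in> V.span ?U" if "x \<in> carrier (component B i)" for x
        using VB.span_is_subset S(3) that by blast
      have "submodule class_ring {y \<in> carrier (component C i). (\<zero>\<^bsub>component B i\<^esub>, y) \<in> V.span ?U}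
          (component C i)"
      proof (rule submodule.intro)
        show "Module.module class_ring (component C i)" by (rule VC.module_axioms)
      qed (use sub(1)[of "(\<zero>\<^bsub>component B i\<^esub>, _)" "(\<zero>\<^bsub>component B i\<^esub>, _)"] sub(2)
          sub(3)[of _ "(\<zero>\<^bsub>component B i\<^esub>, _)"] in auto)
      moreover have "T \<subseteq> {y \<in> carrier (component C i). (\<zero>\<^bsub>component B i\<^esub>, y) \<in> V.span ?U}"
        using T V.in_own_span[OF U] by auto
      ultimately have 2: "(\<zero>\<^bsub>component B i\<^esub>, y) \<in> V.span ?U" if "y \<in> carrier (component C i)" for y
        using VC.span_is_subset T(3) that by blast
      have "(x, y) \<in> V.span ?U" if "x \<in> carrier (component B i)" "y \<in> carrier (component C i)" for x y
        using sub(1)[OF 1[OF that(1)] 2[OF that(2)]] that by simp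
      then have "V.gen_set ?U" using V.span_is_subset2[OF U] by (auto simp: car)
      moreover have "finite ?U" using S(1) T(1) by simp
      ultimately show ?thesis unfolding V.fin_dim_def using U by (intro exI[of _ ?U] conjI)
    qed
  qed
  then show ?thesis by (simp add: finite_type_def)
qed

end

theory Submission
  imports Defs
begin

text \<open>
  Each Betti number is the dimension of the cocycles minus that of the coboundaries. In degrees
  \<open>i \<ge> 1\<close> the cocycles of \<open>(B \<or> C, (b, c))\<close> are the product of those of \<open>(B, b)\<close> and \<open>(C, c)\<close>, and in
  degrees \<open>i \<ge> 2\<close> so are the coboundaries. The 1-coboundaries of a connected algebra form the line
  spanned by \<open>a\<close>, so in degree 1 the additive quantity is the Betti number, increased by 1 when
  \<open>a \<noteq> 0\<close>; for \<open>a = 0\<close> the Betti number is \<open>dim A\<^sup>1\<close>.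
\<close>

section \<open>Dimensions\<close>

lemma linear_mapI:
  assumes "vectorspace K V" and "vectorspace K W"
    and "\<And>v. v \<in> carrier V \<Longrightarrow> T v \<in> carrier W"
    and "\<And>u v. \<lbrakk>u \<in> carrier V; v \<in> carrier V\<rbrakk> \<Longrightarrow> T (u \<oplus>\<^bsub>V\<^esub> v) = T u \<oplus>\<^bsub>W\<^esub> T v"
    and "\<And>k v. \<lbrakk>k \<in> carrier K; v \<in> carrier V\<rbrakk> \<Longrightarrow> T (k \<odot>\<^bsub>V\<^esub> v) = k \<odot>\<^bsub>W\<^esub> T v"
  shows "linear_map K V W T"
  using assms
  by (auto simp: linear_map_def mod_hom_def mod_hom_axioms_def LinearCombinations.module_hom_def
      vectorspace_def)

text \<open>Sets in \<open>W\<close> that are independent in \<open>W\<close> stay independent in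
  \<open>V\<close>, so their size is bounded by \<open>dim\<close>. A maximal one therefore exists,
  and it is a finite basis of \<open>W\<close>.\<close>

lemma (in vectorspace) subspace_fin_dim:
  assumes "fin_dim" and "subspace K W V"
  shows "vectorspace.fin_dim K (vs W)"
proof -
  interpret W: vectorspace K "vs W" by (rule subspace_is_vs[OF assms(2)])
  have sub: "submodule K W V" using assms(2) by simp
  have "W \<subseteq> carrier V" using submodule.subset[OF sub] .
  then have "finite S \<and> card S \<le> dim" if "S \<subseteq> W \<and> W.lin_indpt S" for S
    using li_le_dim[OF assms(1), of S] that span_li_not_depend(2)[OF _ sub, of S] by auto
  moreover have "{} \<subseteq> W \<and> W.lin_indpt {}" by (simp add: W.lin_dep_def)
  ultimately obtain S where "finite S" "maximal S (\<lambda>S. S \<subseteq> W \<and> W.lin_indpt S)"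
    using maximal_exists[of "\<lambda>S. S \<subseteq> W \<and> W.lin_indpt S" dim "{}"] by metis
  then show ?thesis
    using W.max_li_is_basis[of S] unfolding W.basis_def W.fin_dim_def by auto
qed

text \<open>Rank-nullity for the projection onto cosets, which is onto and has kernel
  \<open>W\<close> because \<open>W\<close> itself is the zero coset. The additive form avoids
  truncated subtraction of naturals.\<close>

lemma dim_quotient_space:
  assumes "vectorspace K V" and "vectorspace.fin_dim K V" and "subspace K W V"
  shows "vectorspace.dim K (quotient_space V W) + vectorspace.dim K (V\<lparr>carrier := W\<rparr>)
    = vectorspace.dim K V"
proof -
  interpret V: vectorspace K V by fact
  interpret W: submodule K W V using assms(3) by simp
  interpret G: abelian_subgroup W V by (rule subspace_abelian_subgroup[OF assms(1,3)])
  let ?Q = "quotient_space V W"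
  have Q: "carrier ?Q = (\<lambda>v. W +>\<^bsub>V\<^esub> v) ` carrier V"
    by (auto simp: quotient_space_def A_RCOSETS_def')
  interpret T: linear_map K V ?Q "\<lambda>v. W +>\<^bsub>V\<^esub> v"
  proof (rule linear_mapI[OF assms(1) quotient_space_vectorspace[OF assms(1,3)]])
    show "W +>\<^bsub>V\<^esub> (u \<oplus>\<^bsub>V\<^esub> v) = (W +>\<^bsub>V\<^esub> u) \<oplus>\<^bsub>?Q\<^esub> (W +>\<^bsub>V\<^esub> v)"
      if "u \<in> carrier V" "v \<in> carrier V" for u v
      using G.a_rcos_sum[OF that] by (simp add: quotient_space_def)
  qed (simp_all add: Q quotient_space_smult_coset[OF assms(1,3)])
  have "T.ker = W"
  proof -
    have "W +>\<^bsub>V\<^esub> v = W \<longleftrightarrow> v \<in> W" if "v \<in> carrier V" for v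
      using G.a_rcos_self[OF that] G.a_rcos_const by auto
    then show ?thesis using W.subset unfolding T.ker_def by (auto simp: quotient_space_def)
  qed
  moreover have "T.im = carrier ?Q" by (simp add: T.im_def Q)
  ultimately show ?thesis using T.rank_nullity[OF assms(2)] by simp
qed

text \<open>Rank-nullity for \<open>fst\<close>: its image is \<open>V\<close>, and
  \<open>snd\<close> maps its kernel bijectively onto \<open>W\<close>.\<close>

lemma dim_direct_sum:
  assumes V: "vectorspace K V" and W: "vectorspace K W"
    and fin: "vectorspace.fin_dim K (direct_sum V W)"
  shows "vectorspace.dim K (direct_sum V W) = vectorspace.dim K V + vectorspace.dim K W"
proof -
  interpret V: vectorspace K V by fact
  interpret W: vectorspace K W by fact
  let ?D = "direct_sum V W"
  interpret D: vectorspace K ?D by (rule direct_sum_is_vs[OF V W])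
  interpret T: linear_map K ?D V fst
    by (rule linear_mapI[OF D.vectorspace_axioms V]) (auto simp: direct_sum_def)
  have ker: "T.ker = {\<zero>\<^bsub>V\<^esub>} \<times> carrier W" unfolding T.ker_def by (auto simp: direct_sum_def)
  have im: "T.im = carrier V" unfolding T.im_def by (force simp: direct_sum_def)
  have sub: "subspace K T.ker ?D" by (rule T.kerT_is_subspace)
  interpret S: linear_map K "D.vs T.ker" W snd
    by (rule linear_mapI[OF D.subspace_is_vs[OF sub] W]) (auto simp: ker, auto simp: direct_sum_def)
  have "vectorspace.dim K (D.vs T.ker) = W.dim"
    by (rule S.dim_eq[OF D.subspace_fin_dim[OF fin sub]]) (auto simp: ker inj_on_def image_iff)
  then show ?thesis using T.rank_nullity[OF fin] by (simp add: im)
qed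

section \<open>Betti numbers\<close>

abbreviation cocycle_space :: "'a graded_alg \<Rightarrow> 'a \<Rightarrow> nat \<Rightarrow> (complex, 'a) module" where
  "cocycle_space A a i \<equiv> (component A i)\<lparr>carrier := cocycles A a i\<rparr>"

abbreviation coboundary_space :: "'a graded_alg \<Rightarrow> 'a \<Rightarrow> nat \<Rightarrow> (complex, 'a) module" where
  "coboundary_space A a i \<equiv> (component A i)\<lparr>carrier := coboundaries A a i\<rparr>"

locale finite_type_algebra = graded_commutative_algebra +
  assumes finite_type: "finite_type A"
begin

lemma cocycle_space_vectorspace:
  assumes "a \<in> carrier (component A 1)"
  shows "cvectorspace (cocycle_space A a i)"
  by (rule vectorspace.subspace_is_vs[OF component_vectorspace subspace_cocycles[OF assms]])

lemma cocycle_space_fin_dim: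
  assumes "a \<in> carrier (component A 1)"
  shows "vectorspace.fin_dim class_ring (cocycle_space A a i)"
  using finite_type subspace_cocycles[OF assms]
  by (auto simp: finite_type_def intro: vectorspace.subspace_fin_dim[OF component_vectorspace])

lemma coboundary_space_vectorspace:
  assumes "a \<in> carrier (component A 1)"
  shows "cvectorspace (coboundary_space A a i)"
  using vectorspace.subspace_is_vs[OF cocycle_space_vectorspace[OF assms]
      subspace_coboundaries[OF assms]] by simp

lemma coboundary_space_fin_dim:
  assumes "a \<in> carrier (component A 1)"
  shows "vectorspace.fin_dim class_ring (coboundary_space A a i)"
  using vectorspace.subspace_fin_dim[OF cocycle_space_vectorspace[OF assms]
      cocycle_space_fin_dim[OF assms] subspace_coboundaries[OF assms]] by simp

lemma betti_add_dim_coboundaries: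
  assumes "a \<in> carrier (component A 1)"
  shows "betti A a i + cdim (coboundary_space A a i) = cdim (cocycle_space A a i)"
  using dim_quotient_space[OF cocycle_space_vectorspace[OF assms]
      cocycle_space_fin_dim[OF assms] subspace_coboundaries[OF assms]]
  by (simp add: betti_def cohomology_def)

text \<open>Connectedness makes \<open>A\<^sup>0\<close> the set of multiples of the unit, and
  \<open>a\<close> times \<open>z\<close> times the unit is \<open>z\<close> times
  \<open>a\<close>.\<close>

lemma coboundaries_degree_one:
  assumes conn: "connected_algebra A" and a: "a \<in> carrier (component A 1)"
  shows "coboundaries A a 1 = range (\<lambda>z. z \<odot>\<^bsub>component A 1\<^esub> a)"
proof -
  have "carrier (component A 0) = range (\<lambda>z. z \<odot>\<^bsub>component A 0\<^esub> gone A)"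
    using conn by (simp add: connected_algebra_def bij_betw_def)
  moreover have "gmult A 1 0 a (z \<odot>\<^bsub>component A 0\<^esub> gone A) = z \<odot>\<^bsub>component A 1\<^esub> a" for z
    using gmult_smult_right[OF a gone_closed, of z] gmult_one_right[OF a] by simp
  ultimately show ?thesis by (simp add: coboundaries_def image_image)
qed

lemma dim_coboundaries_degree_one:
  assumes conn: "connected_algebra A" and a: "a \<in> carrier (component A 1)"
  shows "cdim (coboundary_space A a 1) = (if a = \<zero>\<^bsub>component A 1\<^esub> then 0 else 1)"
proof -
  interpret V: vectorspace class_ring "component A 1" by (rule component_vectorspace)
  interpret L: vectorspace class_ring "coboundary_space A a 1"
    by (rule coboundary_space_vectorspace[OF a])
  have L: "coboundaries A a 1 = range (\<lambda>z. z \<odot>\<^bsub>component A 1\<^esub> a)"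
    by (rule coboundaries_degree_one[OF assms])
  have mem: "a \<in> coboundaries A a 1"
    unfolding L using V.smult_one[OF a] by (intro image_eqI[of _ _ 1]) simp_all
  \<comment> \<open>The span is taken inside the coboundary space, so that \<open>{a}\<close>
    generates it and the dimension depends only on whether this generator vanishes.\<close>
  have "submodule class_ring (L.span {a}) (coboundary_space A a 1)"
    by (rule L.span_is_submodule) (use mem in simp)
  then have "coboundaries A a 1 \<subseteq> L.span {a}"
    using submodule.smult_closed[of class_ring "L.span {a}" "coboundary_space A a 1" _ a]
      L.in_own_span[of "{a}"] mem by (auto simp: L simp del: One_nat_def)
  then have gen: "L.gen_set {a}"
    using L.span_is_subset2[of "{a}"] mem by auto
  show ?thesis
    using L.dim0I L.dim1I[OF gen] gen mem by auto
qed

lemma zero_closed: "\<zero>\<^bsub>component A i\<^esub> \<in> carrier (component A i)"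
proof -
  interpret V: vectorspace class_ring "component A i" by (rule component_vectorspace)
  show ?thesis by (rule V.M.zero_closed)
qed

lemma cocycles_zero: "cocycles A \<zero>\<^bsub>component A 1\<^esub> i = carrier (component A i)"
  using gmult_zero_left[of _ i 1] by (auto simp: cocycles_def)

lemma betti_degree_one:
  assumes "connected_algebra A" and "a \<in> carrier (component A 1)"
  shows "betti A a 1 + (if a = \<zero>\<^bsub>component A 1\<^esub> then 0 else 1) = cdim (cocycle_space A a 1)"
  using betti_add_dim_coboundaries[OF assms(2), of 1] dim_coboundaries_degree_one[OF assms]
  by simp

lemma betti_degree_one_zero:
  assumes "connected_algebra A"
  shows "betti A \<zero>\<^bsub>component A 1\<^esub> 1 = cdim (component A 1)"
  using betti_degree_one[OF assms zero_closed] cocycles_zero[of 1] by simp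

end

section \<open>Coproducts\<close>

locale algebra_pair = B: finite_type_algebra B + C: finite_type_algebra C
  for B :: "'b graded_alg" and C :: "'c graded_alg" +
  assumes connected: "connected_algebra B" "connected_algebra C"
begin

sublocale A: finite_type_algebra "B \<or>\<^sub>g C"
  by (intro finite_type_algebra.intro finite_type_algebra_axioms.intro
      coproduct_graded_commutative_algebra coproduct_finite_type
      B.graded_commutative_algebra_axioms C.graded_commutative_algebra_axioms
      B.finite_type C.finite_type)

context
  fixes b c
  assumes b: "b \<in> carrier (component B 1)" and c: "c \<in> carrier (component C 1)"
begin

lemma bc: "(b, c) \<in> carrier (component (B \<or>\<^sub>g C) 1)"
  using b c by (simp add: coproduct_simps)

text \<open>The differential acts componentwise, so a pair is a cocycle iff both entries are. Degree
  0 is excluded because there the coproduct has only the diagonal multiples of the unit.\<close>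

lemma dim_cocycles_coproduct:
  assumes "i \<ge> 1"
  shows "cdim (cocycle_space (B \<or>\<^sub>g C) (b, c) i)
    = cdim (cocycle_space B b i) + cdim (cocycle_space C c i)"
proof -
  have "cocycles (B \<or>\<^sub>g C) (b, c) i = cocycles B b i \<times> cocycles C c i"
    using assms by (auto simp: cocycles_def coproduct_simps)
  then have "cocycle_space (B \<or>\<^sub>g C) (b, c) i
      = direct_sum (cocycle_space B b i) (cocycle_space C c i)"
    using assms by (simp add: coproduct_def direct_sum_def)
  then show ?thesis
    using dim_direct_sum[OF B.cocycle_space_vectorspace[OF b] C.cocycle_space_vectorspace[OF c]]
      A.cocycle_space_fin_dim[OF bc, of i] by simp
qed

text \<open>Coboundaries of degree \<open>i\<close> come from degree \<open>i - 1\<close>, which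
  must be positive for the component there to be a full product.\<close>

lemma dim_coboundaries_coproduct:
  assumes "i \<ge> 2"
  shows "cdim (coboundary_space (B \<or>\<^sub>g C) (b, c) i)
    = cdim (coboundary_space B b i) + cdim (coboundary_space C c i)"
proof -
  obtain k where k: "i = Suc k" "k \<noteq> 0" using assms by (cases i) auto
  have "coboundaries (B \<or>\<^sub>g C) (b, c) i = coboundaries B b i \<times> coboundaries C c i"
    using k by (auto simp: coboundaries_def coproduct_simps image_iff)
  then have "coboundary_space (B \<or>\<^sub>g C) (b, c) i
      = direct_sum (coboundary_space B b i) (coboundary_space C c i)"
    using k by (simp add: coproduct_def direct_sum_def)
  then show ?thesis
    using dim_direct_sum[OF B.coboundary_space_vectorspace[OF b]
        C.coboundary_space_vectorspace[OF c]]
      A.coboundary_space_fin_dim[OF bc, of i] by simp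
qed

lemma betti_coproduct:
  assumes "i \<ge> 2"
  shows "betti (B \<or>\<^sub>g C) (b, c) i = betti B b i + betti C c i"
  using A.betti_add_dim_coboundaries[OF bc, of i] B.betti_add_dim_coboundaries[OF b, of i]
    C.betti_add_dim_coboundaries[OF c, of i] dim_cocycles_coproduct[of i]
    dim_coboundaries_coproduct[OF assms] assms by simp

text \<open>By additivity of cocycle dimensions, the Betti number plus 1 for a nonzero element is
  additive. If \<open>b\<close> and \<open>c\<close> are both nonzero, two corrections on the right
  meet one on the left, leaving the extra 1. If just one is nonzero, the corrections cancel; a zero
  entry contributes the full dimension of its degree-1 component.\<close>

lemma betti_coproduct_degree_one:
  "betti (B \<or>\<^sub>g C) (b, c) 1 =
    (if b = \<zero>\<^bsub>component B 1\<^esub> then cdim (component B 1) + betti C c 1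
     else if c = \<zero>\<^bsub>component C 1\<^esub> then betti B b 1 + cdim (component C 1)
     else betti B b 1 + betti C c 1 + 1)"
  using A.betti_degree_one[OF coproduct_connected_algebra[OF connected(1)] bc]
    B.betti_degree_one[OF connected(1) b] C.betti_degree_one[OF connected(2) c]
    B.betti_degree_one_zero[OF connected(1)] C.betti_degree_one_zero[OF connected(2)]
    dim_cocycles_coproduct[of 1]
  by (simp add: coproduct_simps split: if_splits)

end

end

theorem proposition4p3:
  fixes B :: "'b graded_alg" and C :: "'c graded_alg" and d s t :: int
  assumes "graded_commutative_algebra B" and "connected_algebra B" and "finite_type B"
    and "graded_commutative_algebra C" and "connected_algebra C" and "finite_type C"
    and "s = d - int (cdim (component B 1))"
    and "t = d - int (cdim (component C 1))"
  shows "resonance 1 d (B \<or>\<^sub>g C) =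
           (\<Union>(j, k)\<in>{(j, k). j + k = d - 1}.
              (resonance 1 j B - {\<zero>\<^bsub>component B 1\<^esub>}) \<times>
              (resonance 1 k C - {\<zero>\<^bsub>component C 1\<^esub>}))
           \<union> ({\<zero>\<^bsub>component B 1\<^esub>} \<times> resonance 1 s C)
           \<union> (resonance 1 t B \<times> {\<zero>\<^bsub>component C 1\<^esub>})
         \<and> (\<forall>i\<ge>2. resonance i d (B \<or>\<^sub>g C) =
              (\<Union>(j, k)\<in>{(j, k). j + k = d}. resonance i j B \<times> resonance i k C))"
proof -
  interpret algebra_pair B C
    using assms by (simp add: algebra_pair_def algebra_pair_axioms_def finite_type_algebra_def
        finite_type_algebra_axioms_def)
  \<comment> \<open>Taking \<open>j\<close> to be \<open>m\<close> leaves
    \<open>k = d - e - m\<close>, possibly negative, which integer indices allow. The cases used are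
    \<open>e = 1\<close> in degree 1 and \<open>e = 0\<close> above.\<close>
  have split: "d \<le> int m + int n + e \<longleftrightarrow> (\<exists>j k. j + k = d - e \<and> j \<le> int m \<and> k \<le> int n)"
    for m n e
    by (rule iffI, rule exI[of _ "int m"], rule exI[of _ "d - e - int m"]) auto
  \<comment> \<open>Stated with \<open>Suc 0\<close> because the simplifier rewrites the degree
    \<open>1\<close> to it.\<close>
  have car: "carrier (component (B \<or>\<^sub>g C) (Suc 0)) =
      carrier (component B (Suc 0)) \<times> carrier (component C (Suc 0))"
    by (simp add: coproduct_simps)
  have eqI: "X = Y" if "\<And>b c. (b, c) \<in> X \<longleftrightarrow> (b, c) \<in> Y" for X Y :: "('b \<times> 'c) set"
    using that by auto
  show ?thesis
  proof (intro conjI allI impI eqI)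
    fix b c
    show "(b, c) \<in> resonance 1 d (B \<or>\<^sub>g C) \<longleftrightarrow>
      (b, c) \<in> (\<Union>(j, k)\<in>{(j, k). j + k = d - 1}.
          (resonance 1 j B - {\<zero>\<^bsub>component B 1\<^esub>}) \<times> (resonance 1 k C - {\<zero>\<^bsub>component C 1\<^esub>}))
        \<union> ({\<zero>\<^bsub>component B 1\<^esub>} \<times> resonance 1 s C)
        \<union> (resonance 1 t B \<times> {\<zero>\<^bsub>component C 1\<^esub>})"
    proof (cases "b \<in> carrier (component B 1) \<and> c \<in> carrier (component C 1)")
      case True
      then have "(b, c) \<in> resonance 1 d (B \<or>\<^sub>g C) \<longleftrightarrow> d \<le> int (betti (B \<or>\<^sub>g C) (b, c) 1)"
        by (simp add: resonance_def car)
      then show ?thesis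
        \<comment> \<open>For nonzero \<open>b\<close> and \<open>c\<close>, \<open>split\<close>
          gives the union. For \<open>b\<close> zero, subtracting the dimension of
          \<open>B\<^sup>1\<close> turns the bound \<open>d\<close> into \<open>s\<close>; for
          \<open>c\<close> zero, \<open>t\<close> arises likewise. At the origin both conditions say
          that \<open>d\<close> is at most the sum of the two dimensions.\<close>
        using True split[of "betti B b 1" "betti C c 1" 1]
          betti_coproduct_degree_one[of b c] assms(7,8)
          B.betti_degree_one_zero[OF connected(1)] C.betti_degree_one_zero[OF connected(2)]
        by (auto simp: resonance_def split: if_splits)
    next
      case False
      \<comment> \<open>The singleton factors on the right also lie in the carriers, so neither side
        contains a pair outside them.\<close>
      moreover have "\<zero>\<^bsub>component B 1\<^esub> \<in> carrier (component B 1)"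
        "\<zero>\<^bsub>component C 1\<^esub> \<in> carrier (component C 1)"
        by (rule B.zero_closed C.zero_closed)+
      ultimately show ?thesis
        by (auto simp: resonance_def car)
    qed
  next
    fix i b c
    assume i: "(2::nat) \<le> i"
    show "(b, c) \<in> resonance i d (B \<or>\<^sub>g C) \<longleftrightarrow>
      (b, c) \<in> (\<Union>(j, k)\<in>{(j, k). j + k = d}. resonance i j B \<times> resonance i k C)"
    proof (cases "b \<in> carrier (component B 1) \<and> c \<in> carrier (component C 1)")
      case True
      then show ?thesis
        using betti_coproduct[OF _ _ i, of b c] split[of "betti B b i" "betti C c i" 0]
        by (auto simp: resonance_def car)
    qed (auto simp: resonance_def car)
  qed
qed

end
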